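(* For any integer $k>0$ the following statements hold true. (a) $\Lambda^k$ is dense in $Gr(2,4)^k$, where the latter has the Zariski topology. (b) Fix finitely many properties $\wp_i$, $1\le i\le s$, about $k$ distinct twistor lines, each of which is true for $k$ general twistor lines. Then there are $k$ distinct twistor lines for which all the $\wp_i$, $1\le i\le s$, are true.
   Context: Let $j:\mathbb{CP}^3\to\mathbb{CP}^3$ be the fixed-point-free anti-holomorphic involution $j[z_0,z_1,z_2,z_3]=[-\bar z_1,\bar z_0,-\bar z_3,\bar z_2]$. A projective line $l\subset\mathbb{CP}^3$ is a twistor line if $j(l)=l$. $Gr(2,4)$ is the Grassmannian of lines in $\mathbb{CP}^3$ and $\Lambda\subset Gr(2,4)$ is the set of all twistor lines. $Gr(2,4)^k$ is the $k$-fold product, an algebraic variety endowed with its Zariski topology. Let $\wp$ be a property which is either true or false for any set of $k$ distinct twistor lines. For $k\ge 2$ extend $\wp$ to all $(L_1,\dots,L_k)\in\Lambda^k$ by declaring it false if $L_m=L_n$ for some $m\ne n$, and otherwise true if and only if it is true for $\{L_1,\dots,L_k\}$. One says that $\wp$ is true for $k$ general twistor lines if there is a non-empty Zariski open subset $U$ of $Gr(2,4)^k$ such that $\wp$ is true for all $(L_1,\dots,L_k)\in U\cap\Lambda^k$. *)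

theory Defs
  imports "HOL-Analysis.Analysis" "HOL-Library.Poly_Mapping"
begin

section \<open>Complex projective 3-space, its lines, and twistor lines\<close>

text \<open>
  A point of projective space is the one-dimensional subspace of \<open>complex^4\<close> that it denotes.
  Homogeneous coordinates \<open>[z\<^sub>0, z\<^sub>1, z\<^sub>2, z\<^sub>3]\<close> are the components at the indices
  \<open>0, 1, 2, 3\<close> of the four-element index type.
\<close>

type_synonym point = "(complex^4) set"
type_synonym line = "point set"

definition cp3 :: "point set" where
  "cp3 = {p. vec.subspace p \<and> vec.dim p = 1}"

definition proj_line :: "(complex^4) set \<Rightarrow> line" where
  "proj_line W = {p \<in> cp3. p \<subseteq> W}"

definition gr24 :: "line set" where
  "gr24 = {proj_line W | W. vec.subspace W \<and> vec.dim W = 2}"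

definition j_lift :: "complex^4 \<Rightarrow> complex^4" where
  "j_lift z = (\<chi> i. if i = 0 then - cnj (z $ 1) else if i = 1 then cnj (z $ 0)
                    else if i = 2 then - cnj (z $ 3) else cnj (z $ 2))"

definition j_map :: "point \<Rightarrow> point" where
  "j_map p = j_lift ` p"

definition twistor_lines :: "line set" where
  "twistor_lines = {l \<in> gr24. j_map ` l = l}"

text \<open>The induced map on points does send \<open>[z]\<close> to \<open>[j_lift z]\<close>.\<close>

lemma j_lift_scale: "j_lift (c *s z) = cnj c *s j_lift z"
  by (simp add: j_lift_def vec_eq_iff)

lemma j_map_span: "j_map (vec.span {z}) = vec.span {j_lift z}"
proof -
  have "range (\<lambda>c. cnj c *s j_lift z) = range (\<lambda>c. c *s j_lift z)"
    by (metis (no_types, lifting) complex_cnj_cnj image_cong image_image surj_def)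
  then show ?thesis
    by (simp add: j_map_def vec.span_singleton image_image j_lift_scale)
qed


section \<open>Multivariate polynomials\<close>

type_synonym 'v mpoly = "('v \<Rightarrow>\<^sub>0 nat) \<Rightarrow>\<^sub>0 complex"

definition eval_monom :: "('v \<Rightarrow> complex) \<Rightarrow> ('v \<Rightarrow>\<^sub>0 nat) \<Rightarrow> complex" where
  "eval_monom x m = (\<Prod>v\<in>Poly_Mapping.keys m. x v ^ Poly_Mapping.lookup m v)"

definition eval_mpoly :: "('v \<Rightarrow> complex) \<Rightarrow> 'v mpoly \<Rightarrow> complex" where
  "eval_mpoly x f =
     (\<Sum>m\<in>Poly_Mapping.keys f. Poly_Mapping.lookup f m * eval_monom x m)"

lemma eval_monom_superset:
  assumes "finite A" "Poly_Mapping.keys m \<subseteq> A"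
  shows "eval_monom x m = (\<Prod>v\<in>A. x v ^ Poly_Mapping.lookup m v)"
  unfolding eval_monom_def using assms
  by (intro prod.mono_neutral_left) (auto simp: in_keys_iff)

lemma eval_monom_add: "eval_monom x (m + n) = eval_monom x m * eval_monom x n"
proof -
  let ?A = "Poly_Mapping.keys m \<union> Poly_Mapping.keys n"
  have "eval_monom x (m + n) = (\<Prod>v\<in>?A. x v ^ Poly_Mapping.lookup (m + n) v)"
    using Poly_Mapping.keys_add[of m n] by (intro eval_monom_superset) auto
  also have "\<dots> = (\<Prod>v\<in>?A. x v ^ Poly_Mapping.lookup m v) * (\<Prod>v\<in>?A. x v ^ Poly_Mapping.lookup n v)"
    by (simp add: lookup_add power_add prod.distrib)
  also have "\<dots> = eval_monom x m * eval_monom x n"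
    by (simp add: eval_monom_superset[of ?A])
  finally show ?thesis .
qed

lemma eval_mpoly_superset:
  assumes "finite A" "Poly_Mapping.keys f \<subseteq> A"
  shows "eval_mpoly x f = (\<Sum>m\<in>A. Poly_Mapping.lookup f m * eval_monom x m)"
  unfolding eval_mpoly_def using assms
  by (intro sum.mono_neutral_left) (auto simp: in_keys_iff)

lemma eval_mpoly_zero [simp]: "eval_mpoly x 0 = 0"
  by (simp add: eval_mpoly_def)

lemma eval_mpoly_one [simp]: "eval_mpoly x 1 = 1"
  by (simp add: eval_mpoly_def eval_monom_def)

lemma eval_mpoly_single [simp]: "eval_mpoly x (Poly_Mapping.single m c) = c * eval_monom x m"
  by (simp add: eval_mpoly_def)

lemma eval_mpoly_add: "eval_mpoly x (f + g) = eval_mpoly x f + eval_mpoly x g"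
proof -
  let ?A = "Poly_Mapping.keys f \<union> Poly_Mapping.keys g"
  have "eval_mpoly x (f + g) = (\<Sum>m\<in>?A. Poly_Mapping.lookup (f + g) m * eval_monom x m)"
    using Poly_Mapping.keys_add[of f g] by (intro eval_mpoly_superset) auto
  also have "\<dots> = (\<Sum>m\<in>?A. Poly_Mapping.lookup f m * eval_monom x m)
                 + (\<Sum>m\<in>?A. Poly_Mapping.lookup g m * eval_monom x m)"
    by (simp add: lookup_add distrib_right sum.distrib)
  also have "\<dots> = eval_mpoly x f + eval_mpoly x g"
    by (simp add: eval_mpoly_superset[of ?A])
  finally show ?thesis .
qed

lemma eval_mpoly_sum: "eval_mpoly x (sum f A) = (\<Sum>a\<in>A. eval_mpoly x (f a))"
  by (induction A rule: infinite_finite_induct) (auto simp: eval_mpoly_add)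

lemma mpoly_sum_single:
  fixes f :: "'v mpoly"
  shows "f = (\<Sum>m\<in>Poly_Mapping.keys f. Poly_Mapping.single m (Poly_Mapping.lookup f m))"
  by (rule poly_mapping_eqI)
    (auto simp: lookup_sum lookup_single when_def in_keys_iff sum.delta)

lemma eval_mpoly_mult: "eval_mpoly x (f * g) = eval_mpoly x f * eval_mpoly x g"
proof -
  have "eval_mpoly x (f * g) =
      eval_mpoly x ((\<Sum>m\<in>Poly_Mapping.keys f. Poly_Mapping.single m (Poly_Mapping.lookup f m)) *
        (\<Sum>m\<in>Poly_Mapping.keys g. Poly_Mapping.single m (Poly_Mapping.lookup g m)))"
    using mpoly_sum_single[of f] mpoly_sum_single[of g] by simp
  also have "\<dots> = eval_mpoly x f * eval_mpoly x g"
    by (simp add: sum_product eval_mpoly_sum mult_single eval_monom_add eval_mpoly_def[of x f]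
        eval_mpoly_def[of x g] mult_ac)
  finally show ?thesis .
qed


section \<open>The Zariski topology on powers of the Grassmannian\<close>

text \<open>
  The Grassmannian is embedded in projective 5-space by the Pluecker coordinates \<open>p\<^sub>a\<^sub>b\<close>, \<open>a < b\<close>.
  The variable \<open>(i, a, b)\<close> stands for the coordinate \<open>p\<^sub>a\<^sub>b\<close> of the \<open>i\<close>-th factor, and the
  closed subsets of the product are the zero loci of families of polynomials which
  are homogeneous in the coordinates of each factor separately.
\<close>

type_synonym pvar = "nat \<times> 4 \<times> 4"

definition plucker :: "(nat \<Rightarrow> complex^4) \<Rightarrow> (nat \<Rightarrow> complex^4) \<Rightarrow> pvar \<Rightarrow> complex" where
  "plucker u v = (\<lambda>(i, a, b). u i $ a * v i $ b - u i $ b * v i $ a)"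

definition multihomogeneous :: "nat \<Rightarrow> (nat \<Rightarrow> nat) \<Rightarrow> pvar mpoly \<Rightarrow> bool" where
  "multihomogeneous k d f \<longleftrightarrow> (\<forall>m\<in>Poly_Mapping.keys f.
     Poly_Mapping.keys m \<subseteq> {..<k} \<times> {(a, b). a < b} \<and>
     (\<forall>i<k. (\<Sum>ab\<in>{(a, b). a < b}. Poly_Mapping.lookup m (i, ab)) = d i))"

definition gr_pow :: "nat \<Rightarrow> (nat \<Rightarrow> line) set" where
  "gr_pow k = {..<k} \<rightarrow>\<^sub>E gr24"

definition twistor_pow :: "nat \<Rightarrow> (nat \<Rightarrow> line) set" where
  "twistor_pow k = {..<k} \<rightarrow>\<^sub>E twistor_lines"

text \<open>
  As the polynomials are multihomogeneous, it does not matter by which vectors \<open>u i\<close>, \<open>v i\<close>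
  the lines are spanned; see \<open>eval_plucker_cong\<close> below.
\<close>

definition zero_locus :: "nat \<Rightarrow> pvar mpoly set \<Rightarrow> (nat \<Rightarrow> line) set" where
  "zero_locus k F = {L \<in> gr_pow k. \<forall>f\<in>F. \<forall>u v.
     (\<forall>i<k. L i = proj_line (vec.span {u i, v i})) \<longrightarrow> eval_mpoly (plucker u v) f = 0}"

definition zariski_open :: "nat \<Rightarrow> (nat \<Rightarrow> line) set \<Rightarrow> bool" where
  "zariski_open k U \<longleftrightarrow>
     (\<exists>F. (\<forall>f\<in>F. \<exists>d. multihomogeneous k d f) \<and> U = gr_pow k - zero_locus k F)"

definition zariski :: "nat \<Rightarrow> (nat \<Rightarrow> line) topology" where
  "zariski k = topology (zariski_open k)"

lemma eval_mpoly_scale: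
  assumes f: "multihomogeneous k d f"
    and y: "\<And>i a b. i < k \<Longrightarrow> y (i, a, b) = c i * x (i, a, b)"
  shows "eval_mpoly y f = (\<Prod>i<k. c i ^ d i) * eval_mpoly x f"
proof -
  let ?P = "{(a, b). a < b} :: (4 \<times> 4) set"
  have "eval_monom y m = (\<Prod>i<k. c i ^ d i) * eval_monom x m" if m: "m \<in> Poly_Mapping.keys f" for m
  proof -
    have sub: "Poly_Mapping.keys m \<subseteq> {..<k} \<times> ?P"
      and deg: "\<And>i. i < k \<Longrightarrow> (\<Sum>ab\<in>?P. Poly_Mapping.lookup m (i, ab)) = d i"
      using f m unfolding multihomogeneous_def by blast+
    have fin: "finite ({..<k} \<times> ?P)" by simp
    have "eval_monom y m =
        (\<Prod>(i, ab)\<in>{..<k} \<times> ?P. (c i * x (i, ab)) ^ Poly_Mapping.lookup m (i, ab))"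
      unfolding eval_monom_superset[OF fin sub]
      by (rule prod.cong) (auto simp: y)
    also have "\<dots> = (\<Prod>(i, ab)\<in>{..<k} \<times> ?P. c i ^ Poly_Mapping.lookup m (i, ab)) *
        (\<Prod>(i, ab)\<in>{..<k} \<times> ?P. x (i, ab) ^ Poly_Mapping.lookup m (i, ab))"
      unfolding prod.distrib[symmetric] by (rule prod.cong) (auto simp: power_mult_distrib)
    also have "(\<Prod>(i, ab)\<in>{..<k} \<times> ?P. x (i, ab) ^ Poly_Mapping.lookup m (i, ab)) = eval_monom x m"
      unfolding eval_monom_superset[OF fin sub] by (rule prod.cong) auto
    also have "(\<Prod>(i, ab)\<in>{..<k} \<times> ?P. c i ^ Poly_Mapping.lookup m (i, ab)) = (\<Prod>i<k. c i ^ d i)"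
      unfolding prod.cartesian_product[symmetric]
      by (rule prod.cong) (simp_all add: power_sum[symmetric] deg)
    finally show ?thesis .
  qed
  then show ?thesis
    by (simp add: eval_mpoly_def sum_distrib_left mult_ac)
qed

lemma proj_line_subset:
  assumes "vec.subspace W" and sub: "proj_line W \<subseteq> proj_line V" and "vec.subspace V"
  shows "W \<subseteq> V"
proof
  fix x assume x: "x \<in> W"
  show "x \<in> V"
  proof (cases "x = 0")
    case True
    then show ?thesis using assms(3) vec.subspace_0 by blast
  next
    case False
    have "vec.span {x} \<subseteq> W"
      using x assms(1) by (simp add: vec.span_minimal)
    moreover have "vec.dim (vec.span {x}) = 1"
      using False vec.dim_eq_card[of "{x}" "vec.span {x}"] by simp
    ultimately have "vec.span {x} \<in> proj_line W"
      by (simp add: proj_line_def cp3_def)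
    then have "vec.span {x} \<subseteq> V" using sub by (auto simp: proj_line_def)
    then show ?thesis using vec.span_base[of x "{x}"] by blast
  qed
qed

lemma span_pairE:
  fixes x u v :: "complex^4"
  assumes "x \<in> vec.span {u, v}"
  obtains a b where "x = a *s u + b *s v"
proof -
  obtain a where "x - a *s u \<in> vec.span {v}"
    using assms vec.span_breakdown_eq[of x u "{v}"] by auto
  then obtain b where "x - a *s u = b *s v" by (auto simp: vec.span_singleton)
  then have "x = a *s u + b *s v" by (simp add: algebra_simps)
  then show ?thesis by (rule that)
qed

lemma eval_plucker_cong:
  assumes f: "multihomogeneous k d f"
    and uv: "\<And>i. i < k \<Longrightarrow> proj_line (vec.span {u i, v i}) = proj_line (vec.span {u' i, v' i})"
    and z: "eval_mpoly (plucker u v) f = 0"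
  shows "eval_mpoly (plucker u' v') f = 0"
proof -
  have "\<exists>c. \<forall>a b. plucker u' v' (i, a, b) = c * plucker u v (i, a, b)" if "i < k" for i
  proof -
    have sub: "vec.span {u' i, v' i} \<subseteq> vec.span {u i, v i}"
      using uv[OF that] by (intro proj_line_subset) auto
    obtain p q where 1: "u' i = p *s u i + q *s v i"
      using sub vec.span_base[of "u' i" "{u' i, v' i}"] span_pairE[of "u' i"] by blast
    obtain r s where 2: "v' i = r *s u i + s *s v i"
      using sub vec.span_base[of "v' i" "{u' i, v' i}"] span_pairE[of "v' i"] by blast
    show ?thesis
      by (intro exI[of _ "p * s - q * r"]) (simp add: plucker_def 1 2 algebra_simps)
  qed
  then obtain c where "\<And>i a b. i < k \<Longrightarrow> plucker u' v' (i, a, b) = c i * plucker u v (i, a, b)"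
    by metis
  from eval_mpoly_scale[OF f, of "plucker u' v'" c "plucker u v", OF this] z show ?thesis by simp
qed

lemma multihomogeneous_mult:
  assumes "multihomogeneous k d f" "multihomogeneous k e g"
  shows "multihomogeneous k (\<lambda>i. d i + e i) (f * g)"
  unfolding multihomogeneous_def
proof
  fix m assume "m \<in> Poly_Mapping.keys (f * g)"
  then obtain a b where m: "m = a + b" "a \<in> Poly_Mapping.keys f" "b \<in> Poly_Mapping.keys g"
    using Poly_Mapping.keys_mult[of f g] by auto
  then show "Poly_Mapping.keys m \<subseteq> {..<k} \<times> {(a, b). a < b} \<and>
     (\<forall>i<k. (\<Sum>ab\<in>{(a, b). a < b}. Poly_Mapping.lookup m (i, ab)) = d i + e i)"
    using assms Poly_Mapping.keys_add[of a b] unfolding multihomogeneous_def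
    by (simp add: lookup_add sum.distrib) blast
qed

lemma istopology_zariski_open: "istopology (zariski_open k)"
  unfolding istopology_def
proof (intro conjI allI impI)
  fix S T assume "zariski_open k S" "zariski_open k T"
  then obtain F G where
    F: "\<forall>f\<in>F. \<exists>d. multihomogeneous k d f" "S = gr_pow k - zero_locus k F" and
    G: "\<forall>g\<in>G. \<exists>d. multihomogeneous k d g" "T = gr_pow k - zero_locus k G"
    unfolding zariski_open_def by blast
  define H where "H = {f * g | f g. f \<in> F \<and> g \<in> G}"
  have H: "\<forall>h\<in>H. \<exists>d. multihomogeneous k d h"
    using F(1) G(1) multihomogeneous_mult unfolding H_def by blast
  have "S \<inter> T = gr_pow k - zero_locus k H"
  proof (intro equalityI subsetI)
    fix L assume L: "L \<in> S \<inter> T"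
    then obtain f u v where f: "f \<in> F" "\<forall>i<k. L i = proj_line (vec.span {u i, v i})"
      "eval_mpoly (plucker u v) f \<noteq> 0"
      using F(2) unfolding zero_locus_def by blast
    obtain g u' v' where g: "g \<in> G" "\<forall>i<k. L i = proj_line (vec.span {u' i, v' i})"
      "eval_mpoly (plucker u' v') g \<noteq> 0"
      using L G(2) unfolding zero_locus_def by blast
    obtain d where d: "multihomogeneous k d g" using G(1) g(1) by blast
    have "eval_mpoly (plucker u v) g \<noteq> 0"
      using eval_plucker_cong[OF d, of u v u' v'] f(2) g(2,3) by auto
    then have "eval_mpoly (plucker u v) (f * g) \<noteq> 0"
      using f(3) by (simp add: eval_mpoly_mult)
    moreover have "f * g \<in> H" using f(1) g(1) by (auto simp: H_def)
    ultimately show "L \<in> gr_pow k - zero_locus k H"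
      using L F(2) f(2) unfolding zero_locus_def by blast
  next
    fix L assume L: "L \<in> gr_pow k - zero_locus k H"
    then obtain f g u v where *: "f \<in> F" "g \<in> G" "\<forall>i<k. L i = proj_line (vec.span {u i, v i})"
      "eval_mpoly (plucker u v) (f * g) \<noteq> 0"
      unfolding zero_locus_def H_def by blast
    then have "eval_mpoly (plucker u v) f \<noteq> 0" "eval_mpoly (plucker u v) g \<noteq> 0"
      by (auto simp: eval_mpoly_mult)
    then show "L \<in> S \<inter> T"
      using * L F(2) G(2) unfolding zero_locus_def by blast
  qed
  with H show "zariski_open k (S \<inter> T)" unfolding zariski_open_def by blast
next
  fix \<U> assume "\<forall>U\<in>\<U>. zariski_open k U"
  then obtain F where F: "\<And>U. U \<in> \<U> \<Longrightarrow> \<forall>f\<in>F U. \<exists>d. multihomogeneous k d f"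
    "\<And>U. U \<in> \<U> \<Longrightarrow> U = gr_pow k - zero_locus k (F U)"
    unfolding zariski_open_def by metis
  have "\<Union>\<U> = (\<Union>U\<in>\<U>. gr_pow k - zero_locus k (F U))"
    using F(2) by auto
  also have "\<dots> = gr_pow k - zero_locus k (\<Union>U\<in>\<U>. F U)"
    unfolding zero_locus_def by blast
  finally have "\<Union>\<U> = gr_pow k - zero_locus k (\<Union>U\<in>\<U>. F U)" .
  moreover have "\<forall>f\<in>(\<Union>U\<in>\<U>. F U). \<exists>d. multihomogeneous k d f"
    using F(1) by blast
  ultimately show "zariski_open k (\<Union>\<U>)"
    unfolding zariski_open_def by (intro exI[of _ "\<Union>U\<in>\<U>. F U"] conjI)
qed

lemma openin_zariski: "openin (zariski k) = zariski_open k"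
  by (simp add: zariski_def istopology_zariski_open)

lemma gr24_spanE:
  assumes "l \<in> gr24"
  obtains u v where "l = proj_line (vec.span {u, v})"
proof -
  obtain W where W: "vec.subspace W" "vec.dim W = 2" "l = proj_line W"
    using assms unfolding gr24_def by blast
  obtain B where B: "B \<subseteq> W" "vec.independent B" "W \<subseteq> vec.span B" "card B = vec.dim W"
    using vec.basis_exists by blast
  have "vec.span B = W" using B W(1) by (simp add: subset_antisym vec.span_minimal)
  moreover obtain u v where "B = {u, v}" using B(4) W(2) by (auto simp: card_2_iff)
  ultimately show ?thesis using W(3) that by metis
qed

lemma topspace_zariski: "topspace (zariski k) = gr_pow k"
proof -
  have "zero_locus k {1} = {}"
  proof -
    have "\<exists>u v. \<forall>i<k. L i = proj_line (vec.span {u i, v i})" if "L \<in> gr_pow k" for L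
    proof -
      have "\<forall>i<k. \<exists>u v. L i = proj_line (vec.span {u, v})"
        using that gr24_spanE unfolding gr_pow_def by (metis PiE_mem lessThan_iff)
      then show ?thesis by metis
    qed
    then show ?thesis unfolding zero_locus_def by auto
  qed
  moreover have "multihomogeneous k (\<lambda>_. 0) 1"
    by (simp add: multihomogeneous_def)
  ultimately have "zariski_open k (gr_pow k)"
    unfolding zariski_open_def by (intro exI[of _ "{1}"]) auto
  moreover have "U \<subseteq> gr_pow k" if "zariski_open k U" for U
    using that unfolding zariski_open_def by blast
  ultimately show ?thesis
    unfolding topspace_def openin_zariski by blast
qed


section \<open>Properties of general twistor lines\<close>

text \<open>
  A property of \<open>k\<close> distinct twistor lines is a predicate on sets of lines, of which only the
  values at the \<open>k\<close>-element subsets of \<^term>\<open>twistor_lines\<close> matter.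
\<close>

definition holds_for_tuple :: "nat \<Rightarrow> (line set \<Rightarrow> bool) \<Rightarrow> (nat \<Rightarrow> line) \<Rightarrow> bool" where
  "holds_for_tuple k P L \<longleftrightarrow> inj_on L {..<k} \<and> P (L ` {..<k})"

definition true_for_general :: "nat \<Rightarrow> (line set \<Rightarrow> bool) \<Rightarrow> bool" where
  "true_for_general k P \<longleftrightarrow>
     (\<exists>U. openin (zariski k) U \<and> U \<noteq> {} \<and> (\<forall>L \<in> U \<inter> twistor_pow k. holds_for_tuple k P L))"

end

theory Submission
  imports Defs "HOL-Computational_Algebra.Polynomial"
begin

text \<open>
  Every pair of vectors has the form \<open>u = p + \<i> q\<close>, \<open>v = j p + \<i> j q\<close>. Along the path
  \<open>u t = p + t q\<close>, \<open>v t = j p + t j q\<close> a polynomial in the Pluecker coordinates is a polynomial in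
  the single variable \<open>t\<close>, and for real \<open>t\<close> the span of \<open>u t\<close> and \<open>v t = j (u t)\<close> is a twistor
  line. A polynomial that does not vanish at \<open>t = \<i>\<close> has finitely many real roots, so it does not
  vanish at some tuple of twistor lines. Real segments between two tuples of twistor lines give in
  the same way that two non-empty open sets meet.
\<close>

section \<open>Polynomials along a path\<close>

lemma eval_mpoly_path:
  assumes "\<And>v. \<exists>Q. \<forall>t. x t v = poly Q t"
  obtains P where "\<And>t. eval_mpoly (x t) f = poly P t"
proof -
  obtain Q where Q: "\<And>v t. x t v = poly (Q v) t"
    using assms by metis
  let ?P = "\<Sum>m\<in>Poly_Mapping.keys f. smult (Poly_Mapping.lookup f m)
      (\<Prod>v\<in>Poly_Mapping.keys m. Q v ^ Poly_Mapping.lookup m v)"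
  have "eval_mpoly (x t) f = poly ?P t" for t
    by (simp add: eval_mpoly_def eval_monom_def Q poly_sum poly_prod poly_power)
  then show ?thesis by (rule that)
qed

text \<open>Each Pluecker coordinate is quadratic in the parameter, so \<open>f\<close> restricts to
  a one-variable polynomial, non-zero because of its value at \<open>c\<close>. The base value
  \<open>c\<close> may be any complex number: it will be \<open>\<i>\<close>, \<open>0\<close> or
  \<open>1\<close>.\<close>

lemma finite_real_roots_plucker_path:
  assumes "eval_mpoly (plucker (\<lambda>i. p i + c *s q i) (\<lambda>i. p' i + c *s q' i)) f \<noteq> 0"
  shows "finite {t :: real. eval_mpoly (plucker (\<lambda>i. p i + of_real t *s q i)
    (\<lambda>i. p' i + of_real t *s q' i)) f = 0}"
proof -
  let ?x = "\<lambda>t. plucker (\<lambda>i. p i + t *s q i) (\<lambda>i. p' i + t *s q' i)"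
  have "\<exists>Q. \<forall>t. ?x t v = poly Q t" for v
  proof -
    obtain i a b where v: "v = (i, a, b)" by (cases v)
    show ?thesis
      by (intro exI[of _ "[:p i $ a, q i $ a:] * [:p' i $ b, q' i $ b:]
            - [:p i $ b, q i $ b:] * [:p' i $ a, q' i $ a:]"])
        (simp add: v plucker_def algebra_simps)
  qed
  then obtain P where P: "\<And>t. eval_mpoly (?x t) f = poly P t"
    using eval_mpoly_path[of ?x f] by blast
  have "P \<noteq> 0" using assms P by auto
  then have "finite ((of_real :: real \<Rightarrow> complex) -` {z. poly P z = 0})"
    by (intro finite_vimageI poly_roots_finite) (auto intro: injI)
  then show ?thesis by (simp add: P vimage_def)
qed

text \<open>Two distinct zeros would force \<open>q = 0\<close> and then \<open>p = 0\<close>. This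
  keeps the moving vector non-zero, so that it still determines a twistor line.\<close>

lemma finite_real_zeros_affine:
  fixes p q :: "complex^'n"
  assumes "p + c *s q \<noteq> 0"
  shows "finite {t :: real. p + of_real t *s q = 0}"
proof -
  have unique: "s = t" if "p + of_real s *s q = 0" "p + of_real t *s q = 0" for s t :: real
  proof (rule ccontr)
    assume "s \<noteq> t"
    have "(of_real s - of_real t :: complex) *s q = 0"
      using that by (metis add_left_cancel vec.scale_left_diff_distrib diff_self)
    then have "q = 0" using \<open>s \<noteq> t\<close> by (simp add: vec.scale_eq_0_iff)
    then show False using that assms by simp
  qed
  show ?thesis
  proof (cases "\<exists>s :: real. p + of_real s *s q = 0")
    case True
    then obtain s :: real where "p + of_real s *s q = 0" by blast
    then have "{t :: real. p + of_real t *s q = 0} \<subseteq> {s}" using unique by blast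
    then show ?thesis using finite_subset by blast
  qed simp
qed

section \<open>Twistor lines\<close>

lemma j_lift_j_lift: "j_lift (j_lift z) = - z"
proof -
  have "i = 0 \<or> i = 1 \<or> i = 2 \<or> i = 3" for i :: 4
    using exhaust_4[of i] by auto
  then show ?thesis by (auto simp: j_lift_def vec_eq_iff)
qed

lemma j_lift_add: "j_lift (x + y) = j_lift x + j_lift y"
  by (auto simp: j_lift_def vec_eq_iff)

lemma j_lift_minus: "j_lift (- x) = - j_lift x"
  using j_lift_scale[of "-1" x] by simp

lemma j_lift_diff: "j_lift (x - y) = j_lift x - j_lift y"
  using j_lift_add[of x "- y"] by (simp add: j_lift_minus)

lemma j_lift_eq_0_iff: "j_lift z = 0 \<longleftrightarrow> z = 0"
  using j_lift_j_lift[of z] j_lift_scale[of 0] by auto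

text \<open>This is the absence of fixed points of \<open>j\<close>: applying \<open>j_lift\<close>
  to \<open>j_lift u = c *s u\<close> gives \<open>- u\<close> as |c|^2 times \<open>u\<close>,
  which is impossible for non-zero \<open>u\<close>.\<close>

lemma j_lift_not_in_span:
  assumes "u \<noteq> 0"
  shows "j_lift u \<notin> vec.span {u}"
proof
  assume "j_lift u \<in> vec.span {u}"
  then obtain c where c: "j_lift u = c *s u" by (auto simp: vec.span_singleton)
  have "- u = cnj c *s (c *s u)"
    using j_lift_scale[of c u] by (simp add: c[symmetric] j_lift_j_lift)
  then have "(cnj c * c + 1) *s u = 0"
    by (metis vec.scale_left_distrib vec.scale_scale vec.scale_one add.left_inverse)
  then have "cnj c * c + 1 = 0" using assms by (metis vec.scale_eq_0_iff)
  then have "cnj c * c = -1" by (simp only: add_eq_0_iff2)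
  then have "Re (cnj c * c) = -1" by simp
  moreover have "Re (cnj c * c) \<ge> 0" by simp
  ultimately show False by linarith
qed

lemma j_map_cp3:
  assumes "p \<in> cp3"
  shows "j_map p \<in> cp3"
proof -
  obtain B where B: "B \<subseteq> p" "vec.independent B" "p \<subseteq> vec.span B" "card B = vec.dim p"
    using vec.basis_exists by blast
  obtain z where z: "B = {z}" using B(4) assms by (auto simp: cp3_def card_1_singleton_iff)
  have "p = vec.span {z}"
    using B z assms by (simp add: cp3_def subset_antisym vec.span_minimal)
  moreover have "z \<noteq> 0" using B(2) z by auto
  ultimately show ?thesis
    using vec.dim_eq_card[of "{j_lift z}" "vec.span {j_lift z}"]
    by (simp add: cp3_def j_map_span j_lift_eq_0_iff)
qed

lemma j_map_j_map:
  assumes "vec.subspace p"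
  shows "j_map (j_map p) = p"
proof -
  have "j_map (j_map p) = uminus ` p" by (simp add: j_map_def image_image j_lift_j_lift)
  also have "\<dots> = p"
    using vec.subspace_neg[OF assms] by (force simp: image_iff)
  finally show ?thesis .
qed

text \<open>By antilinearity and \<open>j_lift_j_lift\<close>, coefficients \<open>a\<close>,
  \<open>b\<close> become \<open>- cnj b\<close>, \<open>cnj a\<close>.\<close>

lemma j_lift_span_pair:
  assumes "x \<in> vec.span {u, j_lift u}"
  shows "j_lift x \<in> vec.span {u, j_lift u}"
proof -
  obtain a b where "x = a *s u + b *s j_lift u" using span_pairE[OF assms] .
  then show ?thesis
    by (auto simp: j_lift_add j_lift_scale j_lift_j_lift intro!: vec.span_diff vec.span_scale
        intro: vec.span_base)
qed

lemma twistor_lineI: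
  assumes "u \<noteq> 0"
  shows "proj_line (vec.span {u, j_lift u}) \<in> twistor_lines"
proof -
  let ?W = "vec.span {u, j_lift u}"
  have ne: "j_lift u \<noteq> u" using j_lift_not_in_span[OF assms] vec.span_base[of u "{u}"] by auto
  have "vec.independent {j_lift u, u}"
    using assms j_lift_not_in_span[OF assms] ne by (simp add: vec.independent_insert)
  then have "vec.dim ?W = 2"
    using ne vec.dim_span_eq_card_independent[of "{j_lift u, u}"] by (simp add: insert_commute)
  then have "proj_line ?W \<in> gr24" unfolding gr24_def by (auto intro!: exI[of _ ?W])
  moreover have "j_map p \<in> proj_line ?W" if "p \<in> proj_line ?W" for p
    using that j_map_cp3 j_lift_span_pair[of _ u] by (auto simp: proj_line_def j_map_def)
  \<comment> \<open>As \<open>j_map\<close> is an involution on points, mapping the line into itself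
    already makes it map onto itself.\<close>
  moreover have "p = j_map (j_map p)" if "p \<in> proj_line ?W" for p
    using that by (simp add: j_map_j_map proj_line_def cp3_def)
  ultimately show ?thesis unfolding twistor_lines_def by blast
qed

lemma gr24_span_pair_nonzero:
  assumes "proj_line (vec.span {u, v}) \<in> gr24"
  shows "u \<noteq> 0"
proof
  assume "u = 0"
  obtain W where W: "vec.subspace W" "vec.dim W = 2" "proj_line (vec.span {u, v}) = proj_line W"
    using assms by (auto simp: gr24_def)
  have "W \<subseteq> vec.span {u, v}" using W by (intro proj_line_subset) auto
  also have "\<dots> = vec.span {v}" using \<open>u = 0\<close> by simp
  finally have "vec.dim W \<le> card {v}" by (intro vec.dim_le_card) auto
  then show False using W(2) by simp
qed

lemma infinite_twistor_lines: "infinite twistor_lines"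
proof -
  define w :: "complex \<Rightarrow> complex^4" where
    "w c = (\<chi> i. if i = 0 then 1 else if i = 2 then c else 0)" for c
  let ?l = "\<lambda>c. proj_line (vec.span {w c, j_lift (w c)})"
  have "inj ?l"
  proof (rule injI)
    fix c d assume "?l c = ?l d"
    then have "vec.span {w c, j_lift (w c)} \<subseteq> vec.span {w d, j_lift (w d)}"
      by (intro proj_line_subset) auto
    then have "w c \<in> vec.span {w d, j_lift (w d)}" using vec.span_base by blast
    then obtain a b where "w c = a *s w d + b *s j_lift (w d)" by (rule span_pairE)
    then have "\<And>i. w c $ i = a * w d $ i + b * j_lift (w d) $ i" by simp
    \<comment> \<open>The vector \<open>j_lift (w d)\<close> vanishes at the indices 0 and 2, so
      index 0 gives \<open>a = 1\<close> and index 2 then gives \<open>c = d\<close>.\<close>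
    from this[of 0] this[of 2] show "c = d" by (simp add: w_def j_lift_def)
  qed
  then have "infinite (range ?l)" using finite_imageD infinite_UNIV_char_0 by blast
  moreover have "w c \<noteq> 0" for c by (auto simp: w_def vec_eq_iff intro!: exI[of _ 0])
  then have "range ?l \<subseteq> twistor_lines" using twistor_lineI by blast
  ultimately show ?thesis using finite_subset by blast
qed

section \<open>Density and irreducibility\<close>

definition twistor_tuple :: "nat \<Rightarrow> (nat \<Rightarrow> complex^4) \<Rightarrow> nat \<Rightarrow> line" where
  "twistor_tuple k u = (\<lambda>i\<in>{..<k}. proj_line (vec.span {u i, j_lift (u i)}))"

lemma twistor_tuple_in:
  assumes "\<forall>i<k. u i \<noteq> 0"
  shows "twistor_tuple k u \<in> twistor_pow k"
  using assms twistor_lineI by (auto simp: twistor_tuple_def twistor_pow_def)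

lemma twistor_pow_subset: "twistor_pow k \<subseteq> gr_pow k"
  unfolding twistor_pow_def gr_pow_def twistor_lines_def by (intro PiE_mono) auto

text \<open>Membership in \<open>zero_locus\<close> demands vanishing for all spanning pairs, so the
  pairs \<open>u i\<close>, \<open>j_lift (u i)\<close> alone can refute it.\<close>

lemma twistor_tuple_not_in_zero_locus:
  assumes "f \<in> F" "eval_mpoly (plucker u (\<lambda>i. j_lift (u i))) f \<noteq> 0"
  shows "twistor_tuple k u \<notin> zero_locus k F"
  using assms unfolding zero_locus_def twistor_tuple_def by fastforce

text \<open>This reduces a non-empty open set to one polynomial: its non-vanishing is attained at
  some tuple of twistor lines and suffices for such a tuple to lie in \<open>U\<close>.\<close>

lemma zariski_open_nonvanishing:
  assumes "zariski_open k U" "U \<noteq> {}"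
  obtains f u where "\<forall>i<k. u i \<noteq> 0" "eval_mpoly (plucker u (\<lambda>i. j_lift (u i))) f \<noteq> 0"
    "\<forall>w. (\<forall>i<k. w i \<noteq> 0) \<and> eval_mpoly (plucker w (\<lambda>i. j_lift (w i))) f \<noteq> 0 \<longrightarrow>
      twistor_tuple k w \<in> U"
proof -
  obtain F where F: "U = gr_pow k - zero_locus k F"
    using assms(1) unfolding zariski_open_def by blast
  obtain L where L: "L \<in> gr_pow k" "L \<notin> zero_locus k F" using F assms(2) by blast
  then obtain f u v where f: "f \<in> F" "\<forall>i<k. L i = proj_line (vec.span {u i, v i})"
    "eval_mpoly (plucker u v) f \<noteq> 0" unfolding zero_locus_def by blast
  have nz: "u i \<noteq> 0" if "i < k" for i
    using L(1) f(2) that gr24_span_pair_nonzero[of "u i" "v i"] by (auto simp: gr_pow_def PiE_iff)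
  \<comment> \<open>These solve \<open>p + \<i> q = u\<close> and \<open>j p + \<i> j q = v\<close>:
    applying \<open>j_lift\<close> to the second equation turns it into
    \<open>- p + \<i> q = j v\<close>.\<close>
  define p where "p i = (1/2) *s (u i - j_lift (v i))" for i
  define q where "q i = (-\<i>/2) *s (u i + j_lift (v i))" for i
  have u: "p i + \<i> *s q i = u i" for i
    by (simp add: p_def q_def vec_eq_iff field_simps)
  have v: "j_lift (p i) + \<i> *s j_lift (q i) = v i" for i
  proof -
    have jp: "j_lift (p i) = (1/2) *s (j_lift (u i) + v i)"
      by (simp add: p_def j_lift_scale j_lift_diff j_lift_j_lift)
    have jq: "j_lift (q i) = (\<i>/2) *s (j_lift (u i) - v i)"
      by (simp add: q_def j_lift_scale j_lift_add j_lift_diff j_lift_minus j_lift_j_lift)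
    show ?thesis unfolding jp jq by (simp add: vec_eq_iff field_simps)
  qed
  let ?w = "\<lambda>t i. p i + t *s q i" and ?w' = "\<lambda>t i. j_lift (p i) + t *s j_lift (q i)"
  let ?A = "{t :: real. eval_mpoly (plucker (?w (of_real t)) (?w' (of_real t))) f = 0}"
  let ?B = "\<Union>i<k. {t :: real. ?w (of_real t) i = 0}"
  have "finite ?A"
    using f(3) by (intro finite_real_roots_plucker_path[where c = \<i>]) (simp add: u v)
  moreover have "finite {t :: real. ?w (of_real t) i = 0}" if "i < k" for i
    using nz[OF that] by (intro finite_real_zeros_affine[where c = \<i>]) (simp add: u)
  then have "finite ?B" by blast
  ultimately have "finite (?A \<union> ?B)" by (intro finite_UnI)
  from ex_new_if_finite[OF infinite_UNIV_char_0 this]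
  obtain t :: real where "t \<notin> ?A \<union> ?B" ..
  \<comment> \<open>Since \<open>j_lift\<close> is antilinear, \<open>?w' t\<close> is the image of
    \<open>?w t\<close> because \<open>t\<close> is real; at \<open>\<i>\<close> this fails, which
    is how arbitrary lines are reached.\<close>
  then have t: "\<forall>i<k. ?w (of_real t) i \<noteq> 0"
    "eval_mpoly (plucker (?w (of_real t)) (\<lambda>i. j_lift (?w (of_real t) i))) f \<noteq> 0"
    by (simp_all add: j_lift_add j_lift_scale)
  show ?thesis
  proof (rule that[OF t], intro allI impI, elim conjE)
    fix w assume "\<forall>i<k. w i \<noteq> 0" "eval_mpoly (plucker w (\<lambda>i. j_lift (w i))) f \<noteq> 0"
    then show "twistor_tuple k w \<in> U"
      using F f(1) twistor_tuple_in[of k w] twistor_pow_subset[of k]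
        twistor_tuple_not_in_zero_locus[of f F w k] by blast
  qed
qed

lemma zariski_open_meets_twistor_pow:
  assumes "zariski_open k U" "U \<noteq> {}"
  shows "U \<inter> twistor_pow k \<noteq> {}"
proof -
  obtain f u where u: "\<forall>i<k. u i \<noteq> 0" "eval_mpoly (plucker u (\<lambda>i. j_lift (u i))) f \<noteq> 0"
    "\<forall>w. (\<forall>i<k. w i \<noteq> 0) \<and> eval_mpoly (plucker w (\<lambda>i. j_lift (w i))) f \<noteq> 0 \<longrightarrow>
      twistor_tuple k w \<in> U"
    using zariski_open_nonvanishing[OF assms] by metis
  then have "twistor_tuple k u \<in> U" by blast
  then show ?thesis using twistor_tuple_in[OF u(1)] by blast
qed

text \<open>This is irreducibility of the product. On the segment from \<open>u\<close> to
  \<open>v\<close> the polynomial of \<open>U\<close> is non-zero at \<open>t = 0\<close> and that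
  of \<open>V\<close> at \<open>t = 1\<close>, so some real \<open>t\<close> avoids the roots of
  both.\<close>

lemma zariski_open_Int_nonempty:
  assumes "zariski_open k U" "U \<noteq> {}" "zariski_open k V" "V \<noteq> {}"
  shows "U \<inter> V \<noteq> {}"
proof -
  obtain f u where f: "\<forall>i<k. u i \<noteq> 0" "eval_mpoly (plucker u (\<lambda>i. j_lift (u i))) f \<noteq> 0"
    "\<forall>w. (\<forall>i<k. w i \<noteq> 0) \<and> eval_mpoly (plucker w (\<lambda>i. j_lift (w i))) f \<noteq> 0 \<longrightarrow>
      twistor_tuple k w \<in> U"
    using zariski_open_nonvanishing[OF assms(1,2)] by metis
  obtain g v where g: "eval_mpoly (plucker v (\<lambda>i. j_lift (v i))) g \<noteq> 0"
    "\<forall>w. (\<forall>i<k. w i \<noteq> 0) \<and> eval_mpoly (plucker w (\<lambda>i. j_lift (w i))) g \<noteq> 0 \<longrightarrow>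
      twistor_tuple k w \<in> V"
    using zariski_open_nonvanishing[OF assms(3,4)] by metis
  define q where "q i = v i - u i" for i
  have v: "u i + q i = v i" for i by (simp add: q_def)
  let ?w = "\<lambda>t i. u i + t *s q i" and ?w' = "\<lambda>t i. j_lift (u i) + t *s j_lift (q i)"
  let ?A = "\<lambda>f. {t :: real. eval_mpoly (plucker (?w (of_real t)) (?w' (of_real t))) f = 0}"
  let ?B = "\<Union>i<k. {t :: real. ?w (of_real t) i = 0}"
  have "finite (?A f)"
    using f(2) by (intro finite_real_roots_plucker_path[where c = 0]) simp
  moreover have "finite (?A g)"
    using g(1) by (intro finite_real_roots_plucker_path[where c = 1])
      (simp add: v j_lift_add[symmetric])
  moreover have "finite {t :: real. ?w (of_real t) i = 0}" if "i < k" for i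
    using f(1) that by (intro finite_real_zeros_affine[where c = 0]) simp
  then have "finite ?B" by blast
  ultimately have "finite (?A f \<union> ?A g \<union> ?B)" by (intro finite_UnI)
  from ex_new_if_finite[OF infinite_UNIV_char_0 this]
  obtain t :: real where "t \<notin> ?A f \<union> ?A g \<union> ?B" ..
  then have t: "\<forall>i<k. ?w (of_real t) i \<noteq> 0"
    "eval_mpoly (plucker (?w (of_real t)) (\<lambda>i. j_lift (?w (of_real t) i))) f \<noteq> 0"
    "eval_mpoly (plucker (?w (of_real t)) (\<lambda>i. j_lift (?w (of_real t) i))) g \<noteq> 0"
    by (simp_all add: j_lift_add j_lift_scale)
  have "twistor_tuple k (?w (of_real t)) \<in> U"
    using f(3)[THEN spec, THEN mp, OF conjI, OF t(1,2)] .
  moreover have "twistor_tuple k (?w (of_real t)) \<in> V"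
    using g(2)[THEN spec, THEN mp, OF conjI, OF t(1,3)] .
  ultimately show ?thesis by blast
qed

lemma openin_zariski_INT_nonempty:
  assumes "finite I" "I \<noteq> {}" "\<forall>i\<in>I. openin (zariski k) (U i) \<and> U i \<noteq> {}"
  shows "(\<Inter>i\<in>I. U i) \<noteq> {}"
proof -
  \<comment> \<open>Openness is carried through the induction because the step intersects two open
    sets. The induction starts at a singleton, as an empty intersection would be
    \<open>UNIV\<close>, which is not open here.\<close>
  have "openin (zariski k) (\<Inter>i\<in>I. U i) \<and> (\<Inter>i\<in>I. U i) \<noteq> {}"
    using assms
  proof (induction I rule: finite_ne_induct)
    case (insert i I)
    then have i: "openin (zariski k) (U i)" "U i \<noteq> {}"
      and I: "openin (zariski k) (\<Inter>i\<in>I. U i)" "(\<Inter>i\<in>I. U i) \<noteq> {}"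
      by simp_all
    have "U i \<inter> (\<Inter>i\<in>I. U i) \<noteq> {}"
      using i I unfolding openin_zariski by (rule zariski_open_Int_nonempty)
    then show ?case using openin_Int[OF i(1) I(1)] by simp
  qed auto
  then show ?thesis ..
qed

theorem lemma3p2:
  fixes k :: nat
  assumes "k > 0"
  shows "zariski k closure_of twistor_pow k = gr_pow k \<and>
    (\<forall>(s :: nat) (P :: nat \<Rightarrow> line set \<Rightarrow> bool).
       (\<forall>i\<in>{1..s}. true_for_general k (P i)) \<longrightarrow>
       (\<exists>S. S \<subseteq> twistor_lines \<and> card S = k \<and> (\<forall>i\<in>{1..s}. P i S)))"
proof (intro conjI allI impI)
  show "zariski k closure_of twistor_pow k = gr_pow k"
  proof -
    have "twistor_pow k \<inter> U \<noteq> {}" if "openin (zariski k) U" "U \<noteq> {}" for U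
      using zariski_open_meets_twistor_pow[of k U] that
      unfolding openin_zariski Int_commute[of U] .
    then have "zariski k closure_of twistor_pow k = topspace (zariski k)"
      unfolding dense_intersects_open by blast
    then show ?thesis by (simp add: topspace_zariski)
  qed
next
  fix s :: nat and P :: "nat \<Rightarrow> line set \<Rightarrow> bool"
  assume P: "\<forall>i\<in>{1..s}. true_for_general k (P i)"
  show "\<exists>S. S \<subseteq> twistor_lines \<and> card S = k \<and> (\<forall>i\<in>{1..s}. P i S)"
  \<comment> \<open>With no property to enforce distinctness, \<open>k\<close> distinct lines come
    from the infinitude of \<open>twistor_lines\<close>.\<close>
  proof (cases "s = 0")
    case True
    then show ?thesis
      using infinite_arbitrarily_large[OF infinite_twistor_lines, of k] by auto
  next
    case False
    obtain U where U: "\<And>i. i \<in> {1..s} \<Longrightarrow> openin (zariski k) (U i) \<and> U i \<noteq> {}"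
      "\<And>i L. i \<in> {1..s} \<Longrightarrow> L \<in> U i \<inter> twistor_pow k \<Longrightarrow> holds_for_tuple k (P i) L"
      using P unfolding true_for_general_def by metis
    have "(\<Inter>i\<in>{1..s}. U i) \<noteq> {}"
      using U(1) False by (intro openin_zariski_INT_nonempty[where k = k]) auto
    moreover have "openin (zariski k) (\<Inter>i\<in>{1..s}. U i)"
      using U(1) False by (intro openin_INT2) auto
    ultimately have "(\<Inter>i\<in>{1..s}. U i) \<inter> twistor_pow k \<noteq> {}"
      unfolding openin_zariski by (intro zariski_open_meets_twistor_pow)
    then obtain L where L: "L \<in> twistor_pow k" "\<And>i. i \<in> {1..s} \<Longrightarrow> L \<in> U i" by blast
    have hold: "holds_for_tuple k (P i) L" if "i \<in> {1..s}" for i using U(2) L that by blast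
    \<comment> \<open>Distinctness is part of any single property holding for the tuple; index 1 is
      available as \<open>s\<close> is positive.\<close>
    have "inj_on L {..<k}" using hold[of 1] False by (simp add: holds_for_tuple_def)
    then have "card (L ` {..<k}) = k" by (simp add: card_image)
    moreover have "L ` {..<k} \<subseteq> twistor_lines" using L(1) by (auto simp: twistor_pow_def)
    ultimately show ?thesis using hold by (auto simp: holds_for_tuple_def)
  qed
qed

end
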